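(* Let $I$ be a non-degenerate interval and $f:I\to\mathbb{R}$ continuous whose graph $\{(x,f(x)):x\in I\}\subseteq\mathbb{R}^2$ is $\sigma$-monotone. Then the set of points where $f$ has a derivative (finite or infinite) is perfectly dense in $I$, i.e. its intersection with every nonempty open subset of $I$ contains a perfect set.
   Context: A metric space $(X,d)$ is monotone if there are a linear order $<$ on $X$ and $c>0$ with $d(x,y)\le c\,d(x,z)$ whenever $x<y<z$; it is $\sigma$-monotone if it is a countable union of monotone subspaces. The graph carries the Euclidean metric. *)

theory Defs
  imports "HOL-Analysis.Analysis" "HOL-Library.Extended_Real"
begin

definition monotone_set :: "'a::metric_space set \<Rightarrow> bool" where
  "monotone_set S \<longleftrightarrow> (\<exists>r c. linear_order_on S r \<and> c > 0 \<and>
     (\<forall>x\<in>S. \<forall>y\<in>S. \<forall>z\<in>S.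
        (x, y) \<in> r \<and> x \<noteq> y \<and> (y, z) \<in> r \<and> y \<noteq> z \<longrightarrow> dist x y \<le> c * dist x z))"

definition sigma_monotone :: "'a::metric_space set \<Rightarrow> bool" where
  "sigma_monotone S \<longleftrightarrow> (\<exists>A :: nat \<Rightarrow> 'a set. (\<forall>n. monotone_set (A n)) \<and> S = (\<Union>n. A n))"

definition has_ext_derivative_within :: "(real \<Rightarrow> real) \<Rightarrow> real \<Rightarrow> real set \<Rightarrow> bool" where
  "has_ext_derivative_within f x I \<longleftrightarrow>
     (\<exists>L::ereal. ((\<lambda>y. ereal ((f y - f x) / (y - x))) \<longlongrightarrow> L) (at x within I))"

definition perfect_set :: "real set \<Rightarrow> bool" where
  "perfect_set P \<longleftrightarrow> P \<noteq> {} \<and> closed P \<and> (\<forall>x\<in>P. x islimpt P)"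

end

theory Submission
  imports Defs
begin

text \<open>By Baire's theorem one of the monotone pieces is dense in the graph over some subinterval.
  Connectedness forces its order to agree with the natural order or its reverse, so over this
  subinterval the graph has bounded turning; in particular \<open>f u = f v\<close> implies
  \<open>\<bar>f w - f u\<bar> \<le> c * (v - u)\<close> for \<open>u \<le> w \<le> v\<close>.

  If \<open>f x + c * x\<close> is nondecreasing there, Lebesgue's theorem on monotone functions gives
  differentiability on a set of positive measure. Otherwise \<open>- f\<close> has a chord of slope greater than
  \<open>c\<close>. Let \<open>g\<close> be the running maximum of \<open>- f\<close> along it. The inverse of \<open>t + g t\<close> is monotone, so by
  Lebesgue's argument it has a derivative below \<open>1 / (1 + c)\<close> on a set of positive measure; at the
  corresponding points \<open>g\<close> has a derivative in \<open>(c, \<infinity>]\<close>, and bounded turning makes \<open>- f\<close> tangent to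
  \<open>g\<close>. Sets of positive measure contain perfect sets, and the continuous injective inverse maps
  these to perfect sets.\<close>

subsection \<open>Derivatives of continuous monotone functions\<close>

text \<open>Only intervals that strictly straddle the point are used, which makes the set a \<open>G\<^sub>\<delta>\<close>; for a
  continuous function this does not change the Dini derivatives. Slopes above \<open>q\<close> are expressed as
  slopes of \<open>- F\<close> below \<open>- q\<close>.\<close>

definition slope_below :: "(real \<Rightarrow> real) \<Rightarrow> real \<Rightarrow> real set" where
  "slope_below F p =
     {x. \<forall>d>0. \<exists>u v. u < x \<and> x < v \<and> v - u < d \<and> F v - F u < p * (v - u)}"

lemma slope_below_borel: "slope_below F p \<in> sets borel"
proof -
  define W where "W n = \<Union>{{u<..<v} |u v. v - u < 1 / real (Suc n) \<and> F v - F u < p * (v - u)}"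
    for n :: nat
  have "slope_below F p = (\<Inter>n. W n)"
  proof (intro equalityI subsetI)
    fix x assume x: "x \<in> slope_below F p"
    have "x \<in> W n" for n
    proof -
      have "1 / real (Suc n) > 0" by simp
      then obtain u v where "u < x" "x < v" "v - u < 1 / real (Suc n)" "F v - F u < p * (v - u)"
        using x unfolding slope_below_def by blast
      then show ?thesis
        unfolding W_def by (intro UnionI[where X = "{u<..<v}"]) auto
    qed
    then show "x \<in> (\<Inter>n. W n)" by blast
  next
    fix x assume x: "x \<in> (\<Inter>n. W n)"
    show "x \<in> slope_below F p"
      unfolding slope_below_def
    proof (intro CollectI allI impI)
      fix d :: real assume "d > 0"
      then obtain n where n: "1 / real (Suc n) < d"
        using nat_approx_posE by blast
      have "x \<in> W n" using x by blast
      then obtain u v where "x \<in> {u<..<v}" "v - u < 1 / real (Suc n)" "F v - F u < p * (v - u)"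
        unfolding W_def by blast
      then show "\<exists>u v. u < x \<and> x < v \<and> v - u < d \<and> F v - F u < p * (v - u)"
        using n by (intro exI[of _ u] exI[of _ v]) auto
    qed
  qed
  moreover have "open (W n)" for n
    unfolding W_def by (rule open_Union) auto
  ultimately show ?thesis
    by (auto intro!: sets.countable_INT borel_open)
qed

text \<open>A chord with one end at \<open>x\<close> keeps its slope below \<open>p\<close>, by
  continuity of \<open>F\<close>, when that end is pushed slightly across \<open>x\<close>; the
  shifted chord straddles \<open>x\<close>.\<close>

lemma frequently_slope_below:
  assumes cont: "isCont F x"
    and freq: "frequently (\<lambda>y. (F y - F x) / (y - x) < p) (at x)"
  shows "x \<in> slope_below F p"
  unfolding slope_below_def
proof (intro CollectI allI impI)
  fix d :: real assume d: "d > 0"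
  \<comment> \<open>The slope condition is tracked by the sign of this expression, which involves no
    division and so passes to nearby \<open>w\<close>.\<close>
  have lim: "((\<lambda>w. F y - F w - p * (y - w)) \<longlongrightarrow> F y - F x - p * (y - x)) (at x within S)" for y S
    using cont by (intro tendsto_intros) (auto simp: isCont_def intro: tendsto_within_subset)
  have "\<exists>y. y \<noteq> x \<and> dist y x < d/2 \<and> (F y - F x) / (y - x) < p"
    using freq d unfolding frequently_at by (meson half_gt_zero UNIV_I)
  then obtain y where y: "y \<noteq> x" "\<bar>y - x\<bar> < d/2" "(F y - F x) / (y - x) < p"
    by (auto simp: dist_real_def)
  show "\<exists>u v. u < x \<and> x < v \<and> v - u < d \<and> F v - F u < p * (v - u)"
  proof (cases "y > x")
    case True
    then have "F y - F x - p * (y - x) < 0" using y by (simp add: field_simps)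
    then have ev: "\<forall>\<^sub>F w in at_left x. F y - F w - p * (y - w) < 0"
      using lim order_tendstoD(2) by blast
    have "\<forall>\<^sub>F w in at_left x. w \<in> {x - d/2<..<x}"
      using d by (intro eventually_at_left_real) auto
    with ev have "\<forall>\<^sub>F w in at_left x. F y - F w - p * (y - w) < 0 \<and> w \<in> {x - d/2<..<x}"
      by eventually_elim auto
    then obtain w where "F y - F w - p * (y - w) < 0" "w \<in> {x - d/2<..<x}"
      using eventually_happens' trivial_limit_at_left_real by blast
    then show ?thesis using True y by (intro exI[of _ w] exI[of _ y]) auto
  next
    case False
    then have less: "y < x" using y by auto
    then have "F y - F x - p * (y - x) > 0" using y by (simp add: field_simps)
    then have ev: "\<forall>\<^sub>F w in at_right x. F y - F w - p * (y - w) > 0"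
      using lim order_tendstoD(1) by blast
    have "\<forall>\<^sub>F w in at_right x. w \<in> {x<..<x + d/2}"
      using d by (intro eventually_at_right_real) auto
    with ev have "\<forall>\<^sub>F w in at_right x. F y - F w - p * (y - w) > 0 \<and> w \<in> {x<..<x + d/2}"
      by eventually_elim auto
    then obtain w where "F y - F w - p * (y - w) > 0" "w \<in> {x<..<x + d/2}"
      using eventually_happens' trivial_limit_at_right_real by blast
    then show ?thesis using less y by (intro exI[of _ y] exI[of _ w]) (auto simp: algebra_simps)
  qed
qed

text \<open>Each point of \<open>S\<close> lies in arbitrarily short intervals of slope below
  \<open>p\<close>, and openness of \<open>U\<close> lets them be taken inside \<open>U\<close>.
  Vitali's theorem selects a disjoint family covering almost all of \<open>S\<close>.\<close>

lemma Vitali_covering_slope_below: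
  assumes S: "S \<subseteq> slope_below F p" "S \<subseteq> U" and U: "open U"
  obtains C where "countable C"
    "\<And>u v. (u, v) \<in> C \<Longrightarrow> u < v \<and> {u<..<v} \<subseteq> U \<and> F v - F u < p * (v - u)"
    "disjoint_family_on (\<lambda>i. {fst i<..<snd i}) C"
    "negligible (S - (\<Union>i\<in>C. {fst i<..<snd i}))"
proof -
  define K where "K = {(u, v). u < v \<and> {u<..<v} \<subseteq> U \<and> F v - F u < p * (v - u)}"
  \<comment> \<open>Midpoint and half-length turn the intervals into balls, to match Vitali's
    theorem for balls.\<close>
  define m where "m i = (fst i + snd i) / 2" for i :: "real \<times> real"
  define r where "r i = (snd i - fst i) / 2" for i :: "real \<times> real"
  have ball: "ball (m i) (r i) = {fst i<..<snd i}" for i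
    by (auto simp: m_def r_def ball_eq_greaterThanLessThan field_simps)
  have "\<exists>i. i \<in> K \<and> x \<in> ball (m i) (r i) \<and> r i < d" if x: "x \<in> S" and d: "0 < d" for x d
  proof -
    obtain e where e: "e > 0" "ball x e \<subseteq> U"
      using S U x by (meson open_contains_ball subsetD)
    then have "min d e > 0" using d by simp
    moreover have "x \<in> slope_below F p" using S x by blast
    ultimately obtain u v where uv: "u < x" "x < v" "v - u < min d e" "F v - F u < p * (v - u)"
      unfolding slope_below_def by blast
    have "{u<..<v} \<subseteq> ball x e" using uv by (auto simp: dist_real_def)
    then have "(u, v) \<in> K" using uv e by (auto simp: K_def)
    then show ?thesis
      using uv unfolding ball by (intro exI[of _ "(u, v)"]) (auto simp: r_def)
  qed
  then obtain C where C: "countable C" "C \<subseteq> K"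
     "pairwise (\<lambda>i j. disjnt (ball (m i) (r i)) (ball (m j) (r j))) C"
     "negligible (S - (\<Union>i \<in> C. ball (m i) (r i)))"
    using Vitali_covering_theorem_balls[of S K m r] by blast
  show ?thesis
  proof
    show "disjoint_family_on (\<lambda>i. {fst i<..<snd i}) C"
      using C(3) unfolding ball pairwise_def disjnt_def disjoint_family_on_def by auto
    show "negligible (S - (\<Union>i\<in>C. {fst i<..<snd i}))"
      using C(4) unfolding ball .
    show "u < v \<and> {u<..<v} \<subseteq> U \<and> F v - F u < p * (v - u)" if "(u, v) \<in> C" for u v
      using C(2) that by (auto simp: K_def)
  qed (fact C(1))
qed

lemma null_sets_lborel_negligible:
  fixes S :: "'a::euclidean_space set"
  assumes "negligible S" "S \<in> sets borel"
  shows "S \<in> null_sets lborel"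
  using assms by (simp add: negligible_iff_null_sets null_sets_completion_iff)

text \<open>Continuity of \<open>T\<close> gives single points no Stieltjes mass, so the end points
  may be dropped from the closed interval.\<close>

lemma emeasure_interval_measure_Ioo:
  assumes "u \<le> v" "mono T" "continuous_on UNIV T"
  shows "emeasure (interval_measure T) {u<..<v} = ennreal (T v - T u)"
proof -
  have [simp]: "emeasure (interval_measure T) {a..b} = ennreal (T b - T a)" if "a \<le> b" for a b
    using that assms by (intro emeasure_interval_measure_Icc) (auto dest: monoD)
  have "{x} \<in> null_sets (interval_measure T)" for x
    using \<open>\<And>a b. a \<le> b \<Longrightarrow> emeasure (interval_measure T) {a..b} = ennreal (T b - T a)\<close>[of x x]
    by (auto simp: null_sets_def)
  then have "{u} \<union> {v} \<in> null_sets (interval_measure T)"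
    by (intro null_sets.Un) auto
  then have "emeasure (interval_measure T) ({u<..<v} \<union> ({u} \<union> {v})) =
      emeasure (interval_measure T) {u<..<v}"
    by (intro emeasure_Un_null_set) auto
  moreover have "{u<..<v} \<union> ({u} \<union> {v}) = {u..v}" using assms by auto
  ultimately show ?thesis using assms(1) by simp
qed

section \<open>Lebesgue measure against the Stieltjes measure of a monotone function\<close>

context
  fixes T :: "real \<Rightarrow> real"
  assumes mono: "mono T" and cont: "continuous_on UNIV T"
begin

text \<open>Sum \<open>T v - T u < p * (v - u)\<close> over the disjoint Vitali intervals, whose
  union is \<open>W\<close>. Keeping \<open>W\<close> inside \<open>U\<close> bounds its Lebesgue
  measure by that of \<open>U\<close>.\<close>

lemma slope_below_open_cover:
  assumes E: "E \<subseteq> slope_below T p" "E \<subseteq> U" and U: "open U" and p: "p \<ge> 0"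
  obtains W where "open W" "W \<subseteq> U" "negligible (E - W)"
    "emeasure (interval_measure T) W \<le> ennreal p * emeasure lborel W"
proof -
  obtain C where C: "countable C"
    "\<And>u v. (u, v) \<in> C \<Longrightarrow> u < v \<and> {u<..<v} \<subseteq> U \<and> T v - T u < p * (v - u)"
    "disjoint_family_on (\<lambda>i. {fst i<..<snd i}) C"
    "negligible (E - (\<Union>i\<in>C. {fst i<..<snd i}))"
    using Vitali_covering_slope_below[OF E U] by blast
  let ?W = "\<Union>i\<in>C. {fst i<..<snd i}"
  have "emeasure (interval_measure T) ?W =
      (\<integral>\<^sup>+ i. emeasure (interval_measure T) {fst i<..<snd i} \<partial>count_space C)"
    using C by (intro emeasure_UN_countable) auto
  also have "\<dots> \<le> (\<integral>\<^sup>+ i. ennreal p * emeasure lborel {fst i<..<snd i} \<partial>count_space C)"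
  proof (intro nn_integral_mono)
    fix i assume "i \<in> space (count_space C)"
    then have "fst i < snd i" "T (snd i) - T (fst i) < p * (snd i - fst i)"
      using C(2)[of "fst i" "snd i"] by auto
    then show "emeasure (interval_measure T) {fst i<..<snd i}
        \<le> ennreal p * emeasure lborel {fst i<..<snd i}"
      using p by (simp add: emeasure_interval_measure_Ioo mono cont ennreal_leI flip: ennreal_mult)
  qed
  also have "\<dots> = ennreal p * (\<integral>\<^sup>+ i. emeasure lborel {fst i<..<snd i} \<partial>count_space C)"
    by (intro nn_integral_cmult) auto
  also have "(\<integral>\<^sup>+ i. emeasure lborel {fst i<..<snd i} \<partial>count_space C) = emeasure lborel ?W"
    using C by (intro emeasure_UN_countable[symmetric]) auto
  finally have *: "emeasure (interval_measure T) ?W \<le> ennreal p * emeasure lborel ?W" .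
  have "?W \<subseteq> U" using C(2) by force
  then show ?thesis
    using C(4) * by (intro that[of ?W]) auto
qed

text \<open>The same summation with the inequality reversed: the Vitali intervals cover almost all
  of \<open>E\<close> and are disjoint inside \<open>U\<close>.\<close>

lemma slope_above_emeasure_le:
  assumes E: "E \<subseteq> slope_below (\<lambda>x. - T x) (- q)" "E \<subseteq> U" "E \<in> sets borel"
    and U: "open U" and q: "q \<ge> 0"
  shows "ennreal q * emeasure lborel E \<le> emeasure (interval_measure T) U"
proof -
  obtain C where C: "countable C"
    "\<And>u v. (u, v) \<in> C \<Longrightarrow> u < v \<and> {u<..<v} \<subseteq> U \<and> - T v - - T u < - q * (v - u)"
    "disjoint_family_on (\<lambda>i. {fst i<..<snd i}) C"
    "negligible (E - (\<Union>i\<in>C. {fst i<..<snd i}))"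
    using Vitali_covering_slope_below[OF E(1,2) U] by blast
  let ?W = "\<Union>i\<in>C. {fst i<..<snd i}"
  have W: "open ?W" "?W \<in> sets borel" by (auto intro!: borel_open)
  have null: "E - ?W \<in> null_sets lborel"
    using C(4) E(3) W(2) by (intro null_sets_lborel_negligible) auto
  have "emeasure lborel E \<le> emeasure lborel (?W \<union> (E - ?W))"
    using E(3) W by (intro emeasure_mono) auto
  also have "\<dots> = emeasure lborel ?W"
    using W null by (intro emeasure_Un_null_set) auto
  also have "\<dots> = (\<integral>\<^sup>+ i. emeasure lborel {fst i<..<snd i} \<partial>count_space C)"
    using C by (intro emeasure_UN_countable) auto
  finally have "ennreal q * emeasure lborel E \<le>
      ennreal q * (\<integral>\<^sup>+ i. emeasure lborel {fst i<..<snd i} \<partial>count_space C)"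
    by (rule mult_left_mono) auto
  also have "\<dots> = (\<integral>\<^sup>+ i. ennreal q * emeasure lborel {fst i<..<snd i} \<partial>count_space C)"
    by (intro nn_integral_cmult[symmetric]) auto
  also have "\<dots> \<le> (\<integral>\<^sup>+ i. emeasure (interval_measure T) {fst i<..<snd i} \<partial>count_space C)"
  proof (intro nn_integral_mono)
    fix i assume "i \<in> space (count_space C)"
    then have "fst i < snd i" "q * (snd i - fst i) < T (snd i) - T (fst i)"
      using C(2)[of "fst i" "snd i"] by auto
    then show "ennreal q * emeasure lborel {fst i<..<snd i}
        \<le> emeasure (interval_measure T) {fst i<..<snd i}"
      using q by (simp add: emeasure_interval_measure_Ioo mono cont ennreal_leI flip: ennreal_mult)
  qed
  also have "\<dots> = emeasure (interval_measure T) ?W"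
    using C by (intro emeasure_UN_countable[symmetric]) auto
  also have "\<dots> \<le> emeasure (interval_measure T) U"
    using C(2) U by (intro emeasure_mono) force+
  finally show ?thesis .
qed

text \<open>Lebesgue's squeeze. Let \<open>e\<close> be the measure of the set. Cover it by
  intervals of slope below \<open>p\<close> inside a neighbourhood of measure at most
  \<open>e + d\<close>, then cover its points in their union by intervals of slope above
  \<open>q\<close>. This gives \<open>q * e \<le> p * (e + d)\<close> for every
  \<open>d > 0\<close>, hence \<open>e = 0\<close>.\<close>

lemma slope_below_Int_above_null:
  assumes "0 \<le> p" "p < q"
  shows "{a<..<b} \<inter> slope_below T p \<inter> slope_below (\<lambda>x. - T x) (- q) \<in> null_sets lborel"
    (is "?E \<in> _")
proof -
  have E: "?E \<in> sets borel" using slope_below_borel by auto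
  define e where "e = measure lborel ?E"
  have "emeasure lborel ?E \<le> emeasure lborel {a<..<b}"
    by (intro emeasure_mono) auto
  also have "\<dots> < \<infinity>" by (cases "a \<le> b") auto
  finally have fin: "emeasure lborel ?E = ennreal e"
    unfolding e_def by (intro emeasure_eq_ennreal_measure) auto
  have "e \<ge> 0" by (simp add: e_def)
  have le: "q * e \<le> p * (e + d)" if d: "d > 0" for d
  proof -
    have "?E \<in> sets lebesgue" using E by auto
    then obtain U where U: "open U" "?E \<subseteq> U" "U - ?E \<in> lmeasurable"
        "emeasure lebesgue (U - ?E) < ennreal d"
      using sets_lebesgue_outer_open d by blast
    obtain W where W: "open W" "W \<subseteq> U" "negligible (?E - W)"
        "emeasure (interval_measure T) W \<le> ennreal p * emeasure lborel W"
      using slope_below_open_cover[of ?E p U] U assms by blast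
    have null: "?E - W \<in> null_sets lborel"
      using W E by (intro null_sets_lborel_negligible) auto
    have "emeasure lborel ?E \<le> emeasure lborel ((?E \<inter> W) \<union> (?E - W))"
      using E W by (intro emeasure_mono) auto
    also have "\<dots> = emeasure lborel (?E \<inter> W)"
      using E W null by (intro emeasure_Un_null_set) auto
    finally have "ennreal q * ennreal e \<le> ennreal q * emeasure lborel (?E \<inter> W)"
      unfolding fin by (rule mult_left_mono) auto
    also have "\<dots> \<le> emeasure (interval_measure T) W"
      using E W assms by (intro slope_above_emeasure_le) auto
    also have "\<dots> \<le> ennreal p * emeasure lborel W" by (fact W(4))
    also have "\<dots> \<le> ennreal p * (ennreal e + ennreal d)"
    proof (intro mult_left_mono)
      have "emeasure lborel W \<le> emeasure lborel (?E \<union> (U - ?E))"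
        using W U E by (intro emeasure_mono) auto
      also have "\<dots> \<le> emeasure lborel ?E + emeasure lborel (U - ?E)"
        using E U by (intro emeasure_subadditive) auto
      also have "emeasure lborel (U - ?E) \<le> ennreal d"
        using U E by (simp add: emeasure_completion less_imp_le)
      finally show "emeasure lborel W \<le> ennreal e + ennreal d"
        unfolding fin by (auto intro: add_left_mono order_trans)
    qed auto
    also have "\<dots> = ennreal (p * (e + d))"
      using assms d \<open>e \<ge> 0\<close> by (simp add: ennreal_mult)
    finally show ?thesis
      using assms d \<open>e \<ge> 0\<close> by (simp flip: ennreal_mult)
  qed
  have "q * e \<le> p * e"
  proof (rule field_le_epsilon)
    fix t :: real assume t: "t > 0"
    \<comment> \<open>Dividing by \<open>p + 1\<close> instead of \<open>p\<close> admits
      \<open>p = 0\<close>.\<close>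
    have "q * e \<le> p * (e + t / (p + 1))"
      using t assms by (intro le) auto
    also have "\<dots> \<le> p * e + t"
      using t assms by (simp add: field_simps)
    finally show "q * e \<le> p * e + t" .
  qed
  then have "e = 0" using assms \<open>e \<ge> 0\<close> by (simp add: mult_le_cancel_right)
  then show ?thesis using E fin by (auto simp: null_sets_def)
qed

end

text \<open>Take a closed subset \<open>K\<close> of positive measure and delete every open set that
  meets \<open>K\<close> in a null set; by Lindelof the deleted part is null. An isolated point of
  the remainder would have a neighbourhood meeting \<open>K\<close> in a null set, so it would have
  been deleted.\<close>

lemma perfect_subset_of_positive_measure:
  fixes E :: "real set"
  assumes E: "E \<in> lmeasurable" "\<not> negligible E"
  obtains P where "perfect_set P" "P \<subseteq> E"
proof -
  have pos: "measure lebesgue E > 0"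
    using E by (simp add: negligible_iff_measure zero_less_measure_iff)
  obtain K where K: "closed K" "K \<subseteq> E" "E - K \<in> lmeasurable"
      "emeasure lebesgue (E - K) < ennreal (measure lebesgue E)"
    using sets_lebesgue_inner_closed[OF fmeasurableD[OF E(1)] pos] by blast
  have "\<not> negligible K"
  proof
    assume "negligible K"
    then have "K \<in> null_sets lebesgue" by (simp add: negligible_iff_null_sets)
    then have "emeasure lebesgue ((E - K) \<union> K) = emeasure lebesgue (E - K)"
      using K by (intro emeasure_Un_null_set) auto
    moreover have "(E - K) \<union> K = E" using K by auto
    ultimately show False
      using K(4) E by (simp add: emeasure_eq_measure2)
  qed
  define \<U> where "\<U> = {U. open U \<and> negligible (K \<inter> U)}"
  obtain \<V> where \<V>: "\<V> \<subseteq> \<U>" "countable \<V>" "\<Union>\<V> = \<Union>\<U>"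
    using Lindelof[of \<U>] unfolding \<U>_def by blast
  have "negligible (\<Union>U\<in>\<V>. K \<inter> U)"
    using \<V> by (intro negligible_countable_Union) (auto simp: \<U>_def)
  moreover have "(\<Union>U\<in>\<V>. K \<inter> U) = K \<inter> \<Union>\<U>" using \<V> by blast
  ultimately have neg: "negligible (K \<inter> \<Union>\<U>)" by simp
  let ?P = "K - \<Union>\<U>"
  have "perfect_set ?P"
    unfolding perfect_set_def
  proof (intro conjI ballI)
    have "open (\<Union>\<U>)" by (auto simp: \<U>_def)
    then show "closed ?P" using K by (simp add: closed_Diff)
    show "?P \<noteq> {}"
      using neg \<open>\<not> negligible K\<close> by (metis Diff_eq_empty_iff inf.absorb1)
    fix x assume x: "x \<in> ?P"
    show "x islimpt ?P"
    proof (rule islimptI)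
      fix V assume V: "x \<in> V" "open V"
      show "\<exists>y\<in>?P. y \<in> V \<and> y \<noteq> x"
      proof (rule ccontr)
        assume "\<not> ?thesis"
        then have "K \<inter> V \<subseteq> {x} \<union> (K \<inter> \<Union>\<U>)" by blast
        moreover have "negligible ({x} \<union> (K \<inter> \<Union>\<U>))" using neg by simp
        ultimately have "negligible (K \<inter> V)" using negligible_subset by blast
        then have "V \<in> \<U>" using V by (simp add: \<U>_def)
        then show False using x V by blast
      qed
    qed
  qed
  then show ?thesis using K that by blast
qed

text \<open>A gap between the lower and the upper derivative would contain rationals
  \<open>r < s\<close>, with slopes below \<open>r\<close> and above \<open>s\<close> both occurring
  arbitrarily close to \<open>x\<close>; assumption \<open>q\<close> keeps the limit finite.
  Rational bounds make the exceptional points a countable union of null sets.\<close>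

lemma has_real_derivative_if_slopes:
  fixes T :: "real \<Rightarrow> real"
  assumes mono: "mono T" and cont: "isCont T x"
    and slopes: "\<And>r s::rat. \<lbrakk>0 \<le> r; r < s; x \<in> slope_below T (of_rat r)\<rbrakk>
                  \<Longrightarrow> x \<notin> slope_below (\<lambda>x. - T x) (- of_rat s)"
    and q: "x \<notin> slope_below (\<lambda>x. - T x) (- q)"
  obtains D where "D \<le> q" "(T has_real_derivative D) (at x)"
proof -
  define Q where "Q y = (T y - T x) / (y - x)" for y
  have Q0: "Q y \<ge> 0" for y
    using mono by (cases y x rule: linorder_cases)
      (auto simp: Q_def mono_def divide_nonpos_neg divide_nonneg_pos)
  have low: "x \<in> slope_below T p" if "frequently (\<lambda>y. Q y < p) (at x)" for p
    using frequently_slope_below[OF cont] that by (simp add: Q_def)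
  have high: "x \<in> slope_below (\<lambda>x. - T x) (- p)" if "frequently (\<lambda>y. Q y > p) (at x)" for p
  proof (rule frequently_slope_below)
    show "isCont (\<lambda>x. - T x) x" using cont by simp
    have "(- T y - - T x) / (y - x) = - Q y" for y
      by (simp add: Q_def minus_divide_left)
    then show "frequently (\<lambda>y. (- T y - - T x) / (y - x) < - p) (at x)"
      using that by simp
  qed
  let ?li = "Liminf (at x) (\<lambda>y. ereal (Q y))" and ?ls = "Limsup (at x) (\<lambda>y. ereal (Q y))"
  have le_q: "eventually (\<lambda>y. Q y \<le> q) (at x)"
    using high[of q] q by (auto simp: frequently_def not_less)
  \<comment> \<open>Monotonicity makes the quotients nonnegative; this yields the
    \<open>0 \<le> r\<close> that \<open>slopes\<close> demands.\<close>
  have li0: "0 \<le> ?li"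
    by (intro Liminf_bounded) (auto simp: Q0)
  have lsq: "?ls \<le> ereal q"
    using le_q by (intro Limsup_bounded) auto
  have "?ls \<le> ?li"
  proof (rule ccontr)
    assume "\<not> ?thesis"
    then obtain s where s: "?li < ereal (real_of_rat s)" "ereal (real_of_rat s) < ?ls"
      using ereal_dense3 not_le by metis
    then obtain r where r: "?li < ereal (real_of_rat r)" "ereal (real_of_rat r) < ereal (real_of_rat s)"
      using ereal_dense3 by blast
    have "0 < ereal (real_of_rat r)" using li0 r by order
    then have "0 \<le> r" by simp
    have "r < s" using r by (simp add: of_rat_less)
    have "frequently (\<lambda>y. Q y < of_rat r) (at x)"
    proof (rule ccontr)
      assume "\<not> ?thesis"
      then have "eventually (\<lambda>y. ereal (of_rat r) \<le> ereal (Q y)) (at x)"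
        by (simp add: frequently_def not_less)
      then have "ereal (of_rat r) \<le> ?li" by (rule Liminf_bounded)
      then show False using r by order
    qed
    moreover have "frequently (\<lambda>y. Q y > of_rat s) (at x)"
    proof (rule ccontr)
      assume "\<not> ?thesis"
      then have "eventually (\<lambda>y. ereal (Q y) \<le> ereal (of_rat s)) (at x)"
        by (simp add: frequently_def not_less)
      then have "?ls \<le> ereal (of_rat s)" by (rule Limsup_bounded)
      then show False using s by order
    qed
    ultimately show False
      using slopes[OF \<open>0 \<le> r\<close> \<open>r < s\<close>] low high by blast
  qed
  then have eq: "?ls = ?li" by (meson Liminf_le_Limsup antisym trivial_limit_at)
  then have lim: "((\<lambda>y. ereal (Q y)) \<longlongrightarrow> ?li) (at x)"
    by (intro tendsto_Liminf) auto
  obtain D where D: "?li = ereal D"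
    using li0 lsq eq by (cases ?li) auto
  have "(Q \<longlongrightarrow> D) (at x)" using lim D by simp
  then have "(T has_real_derivative D) (at x)"
    unfolding Q_def has_field_derivative_iff .
  moreover have "D \<le> q" using lsq eq D by simp
  ultimately show ?thesis using that by blast
qed

text \<open>If almost every point of \<open>{a<..<b}\<close> had arbitrarily short intervals of
  slope above \<open>q\<close> around it, the Stieltjes measure of \<open>{a<..<b}\<close> would be
  at least \<open>q * (b - a)\<close>. So the other points have positive measure, and
  \<open>T\<close> is differentiable at almost all of them.\<close>

lemma perfect_set_small_derivative:
  fixes T :: "real \<Rightarrow> real"
  assumes mono: "mono T" and cont: "continuous_on UNIV T"
    and ab: "a < b" and less: "T b - T a < \<kappa> * (b - a)"
  obtains P where "perfect_set P" "P \<subseteq> {a<..<b}"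
    "\<And>s. s \<in> P \<Longrightarrow> \<exists>D<\<kappa>. (T has_real_derivative D) (at s)"
proof -
  have "(T b - T a) / (b - a) < \<kappa>" using ab less by (simp add: field_simps)
  \<comment> \<open>\<open>q\<close> is strictly below \<open>\<kappa>\<close> because the
    derivative will only satisfy \<open>D \<le> q\<close>.\<close>
  then obtain q where q: "(T b - T a) / (b - a) < q" "q < \<kappa>" using dense by blast
  then have Tq: "T b - T a < q * (b - a)" using ab by (simp add: field_simps)
  have Tab: "T a \<le> T b" using mono ab by (simp add: mono_def)
  then have "0 \<le> (T b - T a) / (b - a)" using ab by simp
  then have q0: "q > 0" using q by linarith
  \<comment> \<open>\<open>N\<close> collects the points with a rational gap between their slopes,
    \<open>H\<close> those with arbitrarily short intervals of slope above \<open>q\<close>.\<close>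
  define N where "N = (\<Union>(r, s)\<in>{(r::rat, s). 0 \<le> r \<and> r < s}.
      {a<..<b} \<inter> slope_below T (of_rat r) \<inter> slope_below (\<lambda>x. - T x) (- of_rat s))"
  define H where "H = {a<..<b} \<inter> slope_below (\<lambda>x. - T x) (- q)"
  have N: "N \<in> null_sets lborel"
    unfolding N_def
  proof (intro null_sets_UN')
    fix i :: "rat \<times> rat" assume "i \<in> {(r, s). 0 \<le> r \<and> r < s}"
    then show "(case i of (r, s) \<Rightarrow> {a<..<b} \<inter> slope_below T (of_rat r) \<inter>
        slope_below (\<lambda>x. - T x) (- of_rat s)) \<in> null_sets lborel"
      using slope_below_Int_above_null[OF mono cont] by (auto simp: of_rat_less)
  qed auto
  have H: "H \<in> sets borel" unfolding H_def using slope_below_borel by auto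
  define E where "E = {a<..<b} - (N \<union> H)"
  have NB: "N \<in> sets borel" using N by auto
  have Eb: "E \<in> sets borel" using NB H by (auto simp: E_def)
  have "E \<in> lmeasurable"
    using Eb by (intro bounded_set_imp_lmeasurable) (auto simp: E_def intro: bounded_subset[OF bounded_closed_interval, of _ a b])
  moreover have "\<not> negligible E"
  proof
    assume "negligible E"
    then have "E \<in> null_sets lborel" using Eb by (rule null_sets_lborel_negligible)
    then have null: "E \<union> N \<in> null_sets lborel" using N by auto
    have "emeasure lborel {a<..<b} \<le> emeasure lborel (H \<union> (E \<union> N))"
      using H Eb NB by (intro emeasure_mono) (auto simp: E_def)
    also have "\<dots> = emeasure lborel H"
      using H null by (intro emeasure_Un_null_set) auto
    finally have "ennreal q * emeasure lborel {a<..<b} \<le> ennreal q * emeasure lborel H"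
      by (rule mult_left_mono) auto
    also have "\<dots> \<le> emeasure (interval_measure T) {a<..<b}"
      using H q0 by (intro slope_above_emeasure_le[OF mono cont]) (auto simp: H_def)
    also have "\<dots> = ennreal (T b - T a)"
      using ab mono cont by (intro emeasure_interval_measure_Ioo) auto
    finally have "ennreal (q * (b - a)) \<le> ennreal (T b - T a)"
      using ab q0 by (simp add: ennreal_mult)
    then show False
      using Tq Tab by simp
  qed
  ultimately obtain P where P: "perfect_set P" "P \<subseteq> E"
    using perfect_subset_of_positive_measure by blast
  show ?thesis
  proof
    show "P \<subseteq> {a<..<b}" using P by (auto simp: E_def)
    fix s assume "s \<in> P"
    then have s: "s \<in> {a<..<b}" "s \<notin> N" "s \<notin> slope_below (\<lambda>x. - T x) (- q)"
      using P by (auto simp: E_def H_def)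
    have "isCont T s" using cont by (simp add: continuous_on_eq_continuous_at)
    then obtain D where "D \<le> q" "(T has_real_derivative D) (at s)"
      using has_real_derivative_if_slopes[OF mono _ _ s(3)] s(1,2) unfolding N_def by blast
    then show "\<exists>D<\<kappa>. (T has_real_derivative D) (at s)" using q(2) le_less_trans by blast
  qed (fact P(1))
qed

subsection \<open>Running maxima\<close>

text \<open>The level set of \<open>y\<close> is compact, so it has a least point \<open>w\<close>;
  an earlier value above \<open>y\<close> would, by the intermediate value theorem, force a still
  earlier hit.\<close>

lemma first_hitting_time:
  fixes f :: "real \<Rightarrow> real"
  assumes cont: "continuous_on {a..b} f" and ab: "a \<le> b" and y: "f a \<le> y" "y \<le> f b"
  obtains w where "w \<in> {a..b}" "f w = y" "\<And>v. v \<in> {a..w} \<Longrightarrow> f v \<le> y"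
proof -
  define S where "S = {v \<in> {a..b}. f v = y}"
  have "compact S"
    unfolding S_def using continuous_closed_preimage_constant[OF cont]
    by (intro compact_eq_bounded_closed[THEN iffD2] conjI) (auto intro: bounded_subset[OF bounded_closed_interval])
  moreover have "S \<noteq> {}"
  proof -
    obtain v where "a \<le> v" "v \<le> b" "f v = y" using IVT'[OF y ab cont] by blast
    then show ?thesis by (auto simp: S_def)
  qed
  ultimately obtain w where w: "w \<in> S" "\<And>v. v \<in> S \<Longrightarrow> w \<le> v"
    using compact_attains_inf[of S] by metis
  show ?thesis
  proof
    show "w \<in> {a..b}" "f w = y" using w by (auto simp: S_def)
    fix v assume v: "v \<in> {a..w}"
    show "f v \<le> y"
    proof (rule ccontr)
      assume "\<not> ?thesis"
      then have less: "y < f v" by simp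
      have "continuous_on {a..v} f"
        using cont v \<open>w \<in> {a..b}\<close> by (elim continuous_on_subset) auto
      then obtain v' where "a \<le> v'" "v' \<le> v" "f v' = y"
        using IVT'[of f a y v] y(1) less_imp_le[OF less] v by auto
      moreover from this have "v' \<in> S" using v \<open>w \<in> {a..b}\<close> by (auto simp: S_def)
      ultimately have "v = w" using w(2)[of v'] v by auto
      then show False using less \<open>f w = y\<close> by simp
    qed
  qed
qed

definition running_max :: "(real \<Rightarrow> real) \<Rightarrow> real \<Rightarrow> real \<Rightarrow> real" where
  "running_max f a t = Sup (f ` {a..t})"

lemma running_max_attained:
  assumes "continuous_on {a..b} f" "t \<in> {a..b}"
  obtains u where "u \<in> {a..t}" "f u = running_max f a t"
    "\<And>w. w \<in> {a..t} \<Longrightarrow> f w \<le> running_max f a t"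
proof -
  have "continuous_on {a..t} f" "{a..t} \<noteq> {}"
    using assms by (auto elim: continuous_on_subset)
  then obtain u where u: "u \<in> {a..t}" "\<And>w. w \<in> {a..t} \<Longrightarrow> f w \<le> f u"
    using continuous_attains_sup[of "{a..t}" f] by auto
  then have "running_max f a t = f u"
    unfolding running_max_def by (intro cSup_eq_maximum) auto
  then show ?thesis using u that by auto
qed

lemma running_max_ge:
  assumes "continuous_on {a..b} f" "a \<le> w" "w \<le> t" "t \<le> b"
  shows "f w \<le> running_max f a t"
proof -
  have "t \<in> {a..b}" "w \<in> {a..t}" using assms by auto
  then show ?thesis using running_max_attained[OF assms(1)] by metis
qed

lemma running_max_mono:
  assumes "continuous_on {a..b} f" "a \<le> s" "s \<le> t" "t \<le> b"
  shows "running_max f a s \<le> running_max f a t"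
proof -
  have "s \<in> {a..b}" using assms by auto
  then obtain u where "u \<in> {a..s}" "f u = running_max f a s"
    using running_max_attained[OF assms(1)] by blast
  then show ?thesis using running_max_ge[OF assms(1), of u t] assms by auto
qed

lemma continuous_on_running_max:
  assumes cont: "continuous_on {a..b} f"
  shows "continuous_on {a..b} (running_max f a)"
  unfolding continuous_on_iff
proof (intro ballI allI impI)
  fix t e :: real assume t: "t \<in> {a..b}" and e: "e > 0"
  have "uniformly_continuous_on {a..b} f"
    using cont by (intro compact_uniformly_continuous) auto
  then obtain d where d: "d > 0"
    "\<And>s t. \<lbrakk>s \<in> {a..b}; t \<in> {a..b}; dist s t < d\<rbrakk> \<Longrightarrow> dist (f s) (f t) < e"
    using e unfolding uniformly_continuous_on_def by metis
  \<comment> \<open>When the window grows from \<open>s\<close> to \<open>r\<close>, the maximum is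
    attained either in the old window or within \<open>d\<close> of \<open>s\<close>, where
    \<open>f\<close> exceeds \<open>f s\<close> by less than \<open>e\<close>.\<close>
  have key: "running_max f a r < running_max f a s + e"
    if "a \<le> s" "s \<le> r" "r \<le> b" "dist s r < d" for s r
  proof -
    have "r \<in> {a..b}" using that by auto
    then obtain u where u: "u \<in> {a..r}" "f u = running_max f a r"
      using running_max_attained[OF cont] by blast
    show ?thesis
    proof (cases "u \<le> s")
      case True
      then have "f u \<le> running_max f a s"
        using running_max_ge[OF cont, of u s] u that by auto
      then show ?thesis using u e by simp
    next
      case False
      then have "dist (f s) (f u) < e"
        using u that by (intro d(2)) (auto simp: dist_real_def)
      moreover have "f s \<le> running_max f a s"
        using running_max_ge[OF cont, of s s] that by auto
      ultimately show ?thesis using u by (auto simp: dist_real_def)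
    qed
  qed
  show "\<exists>d>0. \<forall>s\<in>{a..b}. dist s t < d \<longrightarrow> dist (running_max f a s) (running_max f a t) < e"
  proof (intro exI[of _ d] conjI ballI impI d(1))
    fix s assume s: "s \<in> {a..b}" "dist s t < d"
    show "dist (running_max f a s) (running_max f a t) < e"
    proof (cases "s \<le> t")
      case True
      then show ?thesis
        using key[of s t] running_max_mono[OF cont, of s t] s t by (auto simp: dist_real_def)
    next
      case False
      then show ?thesis
        using key[of t s] running_max_mono[OF cont, of t s] s t by (auto simp: dist_real_def)
    qed
  qed
qed

text \<open>Where the running maximum \<open>g\<close> grows with slope above \<open>c\<close>, the function stays close to it: a value
  \<open>f t < g t\<close> was first reached at some \<open>w \<le> t\<close>, and since \<open>f w = f t\<close>, \<open>g\<close> increases on \<open>[w, t]\<close> with slope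
  at most \<open>c\<close>, so \<open>[w, t]\<close> is negligibly short. The slope is measured through \<open>t + g t\<close>, which is strictly
  increasing, by the inverse quotient \<open>D\<close>, so that \<open>D = 0\<close> covers the slope \<open>\<infinity>\<close>.\<close>

lemma running_max_gap_small:
  fixes f :: "real \<Rightarrow> real" and a b c D t0 :: real
  defines "\<phi> \<equiv> \<lambda>t. t + running_max f a t"
  assumes cont: "continuous_on {a..b} f" and c: "c \<ge> 0"
    and star: "\<And>u w v. \<lbrakk>a \<le> u; u \<le> w; w \<le> v; v \<le> b; f u = f v\<rbrakk> \<Longrightarrow> \<bar>f w - f u\<bar> \<le> c * (v - u)"
    and t0: "t0 \<in> {a<..<b}"
    and lim: "((\<lambda>t. (t - t0) / (\<phi> t - \<phi> t0)) \<longlongrightarrow> D) (at t0)" and D: "(1 + c) * D < 1"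
  shows "f t0 = running_max f a t0"
    and "((\<lambda>t. (running_max f a t - f t) / (\<phi> t - \<phi> t0)) \<longlongrightarrow> 0) (at t0)"
proof -
  let ?g = "running_max f a"
  have phi_less: "\<phi> s < \<phi> t" if "a \<le> s" "s < t" "t \<le> b" for s t
    using running_max_mono[OF cont, of s t] that by (simp add: \<phi>_def)
  \<comment> \<open>If \<open>?g\<close> were constant on \<open>{t1..t0}\<close>, the inverse
    quotient would equal 1 there, forcing \<open>D = 1\<close> against
    \<open>(1 + c) * D < 1\<close>.\<close>
  have left_less: "?g t1 < ?g t0" if "a \<le> t1" "t1 < t0" for t1
  proof (rule ccontr)
    assume "\<not> ?thesis"
    then have eq: "?g t1 = ?g t0"
      using running_max_mono[OF cont, of t1 t0] that t0 by auto
    have "?g t = ?g t0" if "t \<in> {t1<..<t0}" for t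
      using running_max_mono[OF cont, of t1 t] running_max_mono[OF cont, of t t0] that t0 eq \<open>a \<le> t1\<close>
      by auto
    moreover have "\<forall>\<^sub>F t in at_left t0. t \<in> {t1<..<t0}"
      using that by (intro eventually_at_left_real)
    ultimately have "\<forall>\<^sub>F t in at_left t0. (t - t0) / (\<phi> t - \<phi> t0) = 1"
      by (elim eventually_mono) (auto simp: \<phi>_def)
    then have "((\<lambda>t. (t - t0) / (\<phi> t - \<phi> t0)) \<longlongrightarrow> 1) (at_left t0)"
      by (rule tendsto_eventually)
    moreover have "((\<lambda>t. (t - t0) / (\<phi> t - \<phi> t0)) \<longlongrightarrow> D) (at_left t0)"
      using lim by (rule tendsto_within_subset) auto
    ultimately have "D = 1" using tendsto_unique trivial_limit_at_left_real by blast
    then show False using D c by simp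
  qed
  show ft0: "f t0 = ?g t0"
  proof -
    have "t0 \<in> {a..b}" using t0 by auto
    then obtain u where u: "u \<in> {a..t0}" "f u = ?g t0"
      using running_max_attained[OF cont] by blast
    have "f u \<le> ?g u" using running_max_ge[OF cont, of u u] u t0 by auto
    then have "\<not> u < t0" using left_less[of u] u by auto
    then show ?thesis using u by auto
  qed
  have isCont: "isCont f t0"
    using cont t0 by (metis continuous_on_interior interior_atLeastAtMost_real)
  define k where "k = 1 - (1 + c) * D"
  have k: "k > 0" using D by (simp add: k_def)
  have gap: "\<forall>\<^sub>F t in at t0. ?g t - f t \<le> e * \<bar>\<phi> t - \<phi> t0\<bar> \<and> ?g t - f t \<ge> 0" if e: "e > 0" for e
  proof -
    \<comment> \<open>In the final estimate of the increment \<open>B\<close>, the first bound lets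
      half of the left side absorb the \<open>B\<close> term on the right, and the second turns the
      remaining term into \<open>e * A * k\<close>.\<close>
    define h where "h = min (k / (2 * (1 + c))) (e * k / (4 * (1 + c)))"
    have h: "h > 0" "2 * (1 + c) * h \<le> k" "4 * (1 + c) * h \<le> e * k"
    proof -
      have m: "2 * (1 + c) > 0" "4 * (1 + c) > 0" using c by auto
      show "h > 0" using k e c by (simp add: h_def)
      have "h \<le> k / (2 * (1 + c))" "h \<le> e * k / (4 * (1 + c))" by (auto simp: h_def)
      then show "2 * (1 + c) * h \<le> k" "4 * (1 + c) * h \<le> e * k"
        using m by (simp_all only: pos_le_divide_eq mult.commute)
    qed
    have "\<forall>\<^sub>F t in at t0. \<bar>(t - t0) / (\<phi> t - \<phi> t0) - D\<bar> < h"
      using lim h(1) by (auto simp: tendsto_iff dist_real_def)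
    then obtain d0 where d0: "d0 > 0"
      "\<And>t. \<lbrakk>t \<noteq> t0; \<bar>t - t0\<bar> < d0\<rbrakk> \<Longrightarrow> \<bar>(t - t0) / (\<phi> t - \<phi> t0) - D\<bar> < h"
      by (auto simp: eventually_at dist_real_def)
    define d where "d = min d0 (min (t0 - a) (b - t0))"
    have d: "d > 0" "d \<le> d0" "d \<le> t0 - a" "d \<le> b - t0" using d0 t0 by (auto simp: d_def)
    have lin: "\<bar>t - t0 - D * (\<phi> t - \<phi> t0)\<bar> \<le> h * \<bar>\<phi> t - \<phi> t0\<bar>" if t: "\<bar>t - t0\<bar> < d" for t
    proof (cases "t = t0")
      case False
      then have ne: "\<phi> t - \<phi> t0 \<noteq> 0"
        using phi_less[of t t0] phi_less[of t0 t] t d t0 by (cases "t < t0") auto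
      have "t - t0 - D * (\<phi> t - \<phi> t0) = ((t - t0) / (\<phi> t - \<phi> t0) - D) * (\<phi> t - \<phi> t0)"
        using ne by (simp add: field_simps)
      then have "\<bar>t - t0 - D * (\<phi> t - \<phi> t0)\<bar> = \<bar>(t - t0) / (\<phi> t - \<phi> t0) - D\<bar> * \<bar>\<phi> t - \<phi> t0\<bar>"
        by (simp add: abs_mult)
      also have "\<dots> \<le> h * \<bar>\<phi> t - \<phi> t0\<bar>"
        using d0(2)[OF False] t d by (intro mult_right_mono) auto
      finally show ?thesis .
    qed (use h in auto)
    have "f \<midarrow>t0\<rightarrow> f t0" using isCont by (simp add: isCont_def)
    \<comment> \<open>This keeps the first hitting time \<open>w\<close> of the value
      \<open>f t\<close> to the right of \<open>t0 - d/2\<close>, so that \<open>lin\<close> applies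
      at \<open>w\<close> as well as at \<open>t\<close>.\<close>
    moreover have "?g (t0 - d/2) < f t0" using left_less[of "t0 - d/2"] ft0 d by auto
    ultimately have "\<forall>\<^sub>F t in at t0. ?g (t0 - d/2) < f t" by (rule order_tendstoD)
    moreover have "\<forall>\<^sub>F t in at t0. \<bar>t - t0\<bar> < d/2"
      using d by (auto simp: eventually_at dist_real_def intro!: exI[of _ "d/2"])
    ultimately show ?thesis
    proof eventually_elim
      case (elim t)
      then have t: "a \<le> t" "t \<le> b" using d by linarith+
      have ge: "f t \<le> ?g t" using running_max_ge[OF cont, of t t] t by auto
      show ?case
      proof (cases "f t = ?g t")
        case True
        then show ?thesis using e by auto
      next
        case False
        then have less: "f t < ?g t" using ge by simp
        have "t \<in> {a..b}" using t by auto
        then obtain u where u: "u \<in> {a..t}" "f u = ?g t"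
          using running_max_attained[OF cont] by blast
        have "f a \<le> ?g (t0 - d/2)" using running_max_ge[OF cont, of a "t0 - d/2"] d t0 by auto
        then have fa: "f a \<le> f t" using elim by simp
        have "continuous_on {a..u} f" using cont u t by (auto elim: continuous_on_subset)
        then obtain w where w: "w \<in> {a..u}" "f w = f t" "\<And>v. v \<in> {a..w} \<Longrightarrow> f v \<le> f t"
          using first_hitting_time[of a u f "f t"] u fa less by auto
        have wb: "w \<in> {a..b}" using w u t by auto
        obtain w' where "w' \<in> {a..w}" "f w' = ?g w"
          using running_max_attained[OF cont wb] by blast
        \<comment> \<open>Up to its first hitting time \<open>w\<close> the function stays at or
          below \<open>f t\<close>, so the running maximum there is exactly
          \<open>f t\<close>.\<close>
        then have gw: "?g w = f t"
          using w(2) w(3)[of w'] running_max_ge[OF cont, of w w] wb by auto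
        have "\<not> w \<le> t0 - d/2"
          using running_max_mono[OF cont, of w "t0 - d/2"] gw elim wb d t0 by auto
        moreover have wt: "w \<le> t" using w(1) u(1) by simp
        ultimately have near: "\<bar>w - t0\<bar> < d" "\<bar>t - t0\<bar> < d" using elim(2) d(1) by linarith+
        \<comment> \<open>The heights at \<open>w\<close> and \<open>t\<close> agree and the maximum
          point \<open>u\<close> lies between them, so bounded turning limits the rise of
          \<open>?g\<close> on \<open>{w..t}\<close>.\<close>
        have "\<bar>f u - f w\<bar> \<le> c * (t - w)" using star[of w u t] w u t by auto
        then have up: "?g t - ?g w \<le> c * (t - w)" using u w gw by simp
        define A where "A = \<bar>\<phi> t - \<phi> t0\<bar>"
        define B where "B = \<phi> t - \<phi> w"
        have gB: "?g t - f t \<le> B" using gw wt by (simp add: B_def \<phi>_def)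
        have B0: "B \<ge> 0" using gB less by simp
        have B1: "B \<le> (1 + c) * (t - w)" using up by (simp add: B_def \<phi>_def algebra_simps)
        have "t - t0 - D * (\<phi> t - \<phi> t0) \<le> h * A"
          using lin[OF near(2)] by (simp add: A_def)
        moreover have "- (w - t0 - D * (\<phi> w - \<phi> t0)) \<le> h * (A + B)"
        proof -
          have "- (w - t0 - D * (\<phi> w - \<phi> t0)) \<le> h * \<bar>\<phi> w - \<phi> t0\<bar>"
            using lin[OF near(1)] by linarith
          also have "\<dots> \<le> h * (A + B)"
            using h(1) B0 by (intro mult_left_mono) (auto simp: A_def B_def)
          finally show ?thesis .
        qed
        \<comment> \<open>Subtracting the linear approximations at \<open>t\<close> and
          \<open>w\<close> cancels \<open>t0\<close>. Combined with \<open>B1\<close>, the term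
          \<open>(1 + c) * D * B\<close> moves left and leaves \<open>k * B\<close>.\<close>
        ultimately have "t - w \<le> D * B + h * (2 * A + B)"
          by (simp add: B_def algebra_simps)
        then have "(1 + c) * (t - w) \<le> (1 + c) * (D * B + h * (2 * A + B))"
          using c by (intro mult_left_mono) auto
        then have "B * k \<le> (1 + c) * h * (2 * A + B)"
          using B1 by (simp add: k_def algebra_simps)
        moreover have "2 * (1 + c) * h * B \<le> k * B"
          using h(2) B0 by (rule mult_right_mono)
        moreover have "4 * (1 + c) * h * A \<le> e * k * A"
          using h(3) by (rule mult_right_mono) (simp add: A_def)
        ultimately have "B * k \<le> e * A * k" by (simp add: algebra_simps)
        then have "B \<le> e * A" using k by simp
        then show ?thesis using gB ge by (simp add: A_def)
      qed
    qed
  qed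
  show "((\<lambda>t. (?g t - f t) / (\<phi> t - \<phi> t0)) \<longlongrightarrow> 0) (at t0)"
    unfolding tendsto_iff
  proof (intro allI impI)
    fix e :: real assume e: "e > 0"
    then have "e/2 > 0" by simp
    from gap[OF this] show "\<forall>\<^sub>F t in at t0. dist ((?g t - f t) / (\<phi> t - \<phi> t0)) 0 < e"
    proof eventually_elim
      case (elim t)
      \<comment> \<open>Division by zero yields 0, which settles the case of a vanishing
        denominator.\<close>
      show ?case
      proof (cases "\<phi> t - \<phi> t0 = 0")
        case False
        then have "\<bar>(?g t - f t) / (\<phi> t - \<phi> t0)\<bar> \<le> e/2"
          using elim by (simp add: abs_divide divide_le_eq)
        then show ?thesis using e unfolding dist_real_def by linarith
      qed (use e in auto)
    qed
  qed
qed

text \<open>Since \<open>f\<close> meets its running maximum at \<open>t0\<close> and the gap is of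
  smaller order than \<open>\<phi> t - \<phi> t0\<close>, the increment of \<open>t + f t\<close> is
  asymptotic to that of \<open>\<phi>\<close>. So the difference quotient of \<open>f\<close> tends
  to \<open>1 / D - 1\<close>, read as \<open>\<infinity>\<close> for \<open>D = 0\<close>.\<close>

lemma ext_derivative_from_running_max:
  fixes f :: "real \<Rightarrow> real" and a b c D t0 :: real
  defines "\<phi> \<equiv> \<lambda>t. t + running_max f a t"
  assumes cont: "continuous_on {a..b} f" and c: "c \<ge> 0"
    and star: "\<And>u w v. \<lbrakk>a \<le> u; u \<le> w; w \<le> v; v \<le> b; f u = f v\<rbrakk> \<Longrightarrow> \<bar>f w - f u\<bar> \<le> c * (v - u)"
    and t0: "t0 \<in> {a<..<b}"
    and lim: "((\<lambda>t. (t - t0) / (\<phi> t - \<phi> t0)) \<longlongrightarrow> D) (at t0)" and D: "(1 + c) * D < 1"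
  shows "has_ext_derivative_within f t0 UNIV"
proof -
  have ft0: "f t0 = running_max f a t0"
    by (rule running_max_gap_small(1)[OF cont c _ t0 lim[unfolded \<phi>_def] D]) (rule star)
  have gap: "((\<lambda>t. (running_max f a t - f t) / (\<phi> t - \<phi> t0)) \<longlongrightarrow> 0) (at t0)"
    unfolding \<phi>_def
    by (rule running_max_gap_small(2)[OF cont c _ t0 lim[unfolded \<phi>_def] D]) (rule star)
  have phi_less: "\<phi> s < \<phi> t" if "a \<le> s" "s < t" "t \<le> b" for s t
    using running_max_mono[OF cont, of s t] that by (simp add: \<phi>_def)
  have near: "\<forall>\<^sub>F t in at t0. t \<in> {a<..<b} \<and> t \<noteq> t0"
    using eventually_at_in_open[of "{a<..<b}" t0] t0 by (auto elim: eventually_mono)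
  have pos: "\<forall>\<^sub>F t in at t0. 0 < (t - t0) / (\<phi> t - \<phi> t0)"
    using near
  proof eventually_elim
    case (elim t)
    then show ?case
      using phi_less[of t t0] phi_less[of t0 t] t0
      by (cases "t < t0") (auto simp: zero_less_divide_iff)
  qed
  define \<rho> where "\<rho> t = 1 - (running_max f a t - f t) / (\<phi> t - \<phi> t0)" for t
  have rho: "(\<rho> \<longlongrightarrow> 1) (at t0)"
  proof -
    have "(\<rho> \<longlongrightarrow> 1 - 0) (at t0)"
      unfolding \<rho>_def using gap by (intro tendsto_diff tendsto_const)
    then show ?thesis by simp
  qed
  have quot: "\<forall>\<^sub>F t in at t0. (f t - f t0) / (t - t0) = \<rho> t * inverse ((t - t0) / (\<phi> t - \<phi> t0)) - 1"
    using pos near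
  proof eventually_elim
    case (elim t)
    then have ne: "t - t0 \<noteq> 0" "\<phi> t - \<phi> t0 \<noteq> 0" by auto
    have "\<rho> t = (\<phi> t - \<phi> t0 - (running_max f a t - f t)) / (\<phi> t - \<phi> t0)"
      using ne by (simp add: \<rho>_def diff_divide_distrib)
    also have "\<phi> t - \<phi> t0 - (running_max f a t - f t) = f t - f t0 + (t - t0)"
      using ft0 by (simp add: \<phi>_def)
    finally have "\<rho> t * inverse ((t - t0) / (\<phi> t - \<phi> t0)) = (f t - f t0 + (t - t0)) / (t - t0)"
      using ne(2) by simp
    then show ?case using ne(1) by (simp add: add_divide_distrib)
  qed
  show ?thesis
  proof (cases "D = 0")
    case False
    have "((\<lambda>t. \<rho> t * inverse ((t - t0) / (\<phi> t - \<phi> t0)) - 1) \<longlongrightarrow> 1 * inverse D - 1) (at t0)"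
      using False by (intro tendsto_intros rho lim)
    then have "((\<lambda>t. (f t - f t0) / (t - t0)) \<longlongrightarrow> 1 * inverse D - 1) (at t0)"
      using quot by (simp add: tendsto_cong)
    then show ?thesis
      unfolding has_ext_derivative_within_def using tendsto_ereal by blast
  next
    case True
    \<comment> \<open>Positivity of the quotients near \<open>t0\<close> fixes the sign of the
      infinite limit.\<close>
    have "filterlim (\<lambda>t. inverse ((t - t0) / (\<phi> t - \<phi> t0))) at_top (at t0)"
      using lim pos unfolding True by (rule filterlim_inverse_at_top)
    then have "filterlim (\<lambda>t. \<rho> t * inverse ((t - t0) / (\<phi> t - \<phi> t0))) at_top (at t0)"
      using rho by (intro filterlim_tendsto_pos_mult_at_top[where c = 1]) auto
    then have "filterlim (\<lambda>t. - 1 + \<rho> t * inverse ((t - t0) / (\<phi> t - \<phi> t0))) at_top (at t0)"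
      by (intro filterlim_tendsto_add_at_top[where c = "-1"]) auto
    then have "filterlim (\<lambda>t. (f t - f t0) / (t - t0)) at_top (at t0)"
      using quot by (subst filterlim_cong[OF refl refl]) (auto elim: eventually_mono)
    then have "((\<lambda>t. ereal ((f t - f t0) / (t - t0))) \<longlongrightarrow> \<infinity>) (at t0)"
      by (auto simp: tendsto_PInfty filterlim_at_top_dense)
    then show ?thesis
      unfolding has_ext_derivative_within_def by blast
  qed
qed

section \<open>Perfect sets of points with an extended derivative\<close>

lemma perfect_set_continuous_injective_image:
  assumes P: "perfect_set P" "bounded P" and cont: "continuous_on UNIV T" and inj: "inj_on T P"
  shows "perfect_set (T ` P)"
  unfolding perfect_set_def
proof (intro conjI)
  show "T ` P \<noteq> {}" using P by (simp add: perfect_set_def)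
  have "compact P" using P by (simp add: perfect_set_def compact_eq_bounded_closed)
  then show "closed (T ` P)"
    using cont by (intro compact_imp_closed compact_continuous_image) (auto elim: continuous_on_subset)
  show "\<forall>y\<in>T ` P. y islimpt T ` P"
  proof (intro ballI islimptI)
    fix y V assume y: "y \<in> T ` P" and V: "y \<in> V" "open V"
    then obtain s where s: "s \<in> P" "y = T s" by blast
    have "open (T -` V)" using cont V by (simp add: open_vimage)
    moreover have "s islimpt P" using P s by (simp add: perfect_set_def)
    ultimately obtain r where "r \<in> P" "r \<in> T -` V" "r \<noteq> s"
      using s V unfolding islimpt_def by blast
    then show "\<exists>x\<in>T ` P. x \<in> V \<and> x \<noteq> y"
      using inj s by (auto simp: inj_on_def)
  qed
qed

lemma has_ext_derivative_within_uminus: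
  assumes "has_ext_derivative_within (\<lambda>x. - f x) x S"
  shows "has_ext_derivative_within f x S"
proof -
  obtain L where L: "((\<lambda>y. ereal ((- f y - - f x) / (y - x))) \<longlongrightarrow> L) (at x within S)"
    using assms unfolding has_ext_derivative_within_def by blast
  have "((\<lambda>y. - ereal ((- f y - - f x) / (y - x))) \<longlongrightarrow> - L) (at x within S)"
    using L by (rule tendsto_uminus_ereal)
  moreover have "- ereal ((- f y - - f x) / (y - x)) = ereal ((f y - f x) / (y - x))" for y
    by (simp add: minus_divide_left)
  ultimately show ?thesis
    unfolding has_ext_derivative_within_def by auto
qed

text \<open>The strictly increasing \<open>\<phi>\<close> has a monotone inverse \<open>T\<close>,
  and the steep chord makes the average slope of \<open>T\<close> less than
  \<open>1 / (1 + c)\<close>. A perfect set where \<open>T\<close> has such a derivative is carried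
  by \<open>T\<close> into \<open>{a<..<b}\<close>, and there the derivative of \<open>T\<close> is
  the limit of the inverse quotients of \<open>\<phi>\<close>.\<close>

lemma perfect_ext_derivative_steep:
  fixes f :: "real \<Rightarrow> real" and a b c :: real
  assumes cont: "continuous_on {a..b} f" and c: "c \<ge> 0" and ab: "a < b"
    and star: "\<And>u w v. \<lbrakk>a \<le> u; u \<le> w; w \<le> v; v \<le> b; f u = f v\<rbrakk> \<Longrightarrow> \<bar>f w - f u\<bar> \<le> c * (v - u)"
    and steep: "f b - f a > c * (b - a)"
  obtains P where "perfect_set P" "P \<subseteq> {a<..<b}"
    "\<And>t. t \<in> P \<Longrightarrow> has_ext_derivative_within f t UNIV"
proof -
  define \<phi> where "\<phi> t = t + running_max f a t" for t
  have phi_less: "\<phi> s < \<phi> t" if "a \<le> s" "s < t" "t \<le> b" for s t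
    using running_max_mono[OF cont, of s t] that by (simp add: \<phi>_def)
  have phi_cont: "continuous_on {a..b} \<phi>"
    unfolding \<phi>_def by (intro continuous_intros continuous_on_running_max cont)
  have inj: "inj_on \<phi> {a..b}"
    by (intro linorder_inj_onI) (use phi_less in force)+
  have phi_ab: "\<phi> a < \<phi> b" using phi_less ab by simp
  have surj: "\<exists>t\<in>{a..b}. \<phi> t = s" if "s \<in> {\<phi> a..\<phi> b}" for s
    using IVT'[of \<phi> a s b] that phi_cont ab by auto
  have img: "\<phi> ` {a..b} = {\<phi> a..\<phi> b}"
  proof (intro equalityI subsetI)
    fix s assume "s \<in> \<phi> ` {a..b}"
    then obtain t where t: "s = \<phi> t" "a \<le> t" "t \<le> b" by auto
    then show "s \<in> {\<phi> a..\<phi> b}"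
      using phi_less[of a t] phi_less[of t b] by (cases "t = a"; cases "t = b") auto
  qed (use surj in blast)
  define T0 where "T0 = the_inv_into {a..b} \<phi>"
  \<comment> \<open>Clamping extends the inverse constantly beyond
    \<open>{\<phi> a..\<phi> b}\<close>, to a monotone continuous function on the whole
    line.\<close>
  define cl where "cl s = max (\<phi> a) (min (\<phi> b) s)" for s
  define T where "T s = T0 (cl s)" for s
  have T0: "T0 (\<phi> t) = t" if "t \<in> {a..b}" for t
    unfolding T0_def using inj that by (rule the_inv_into_f_f)
  have T: "T (\<phi> t) = t" if "t \<in> {a..b}" for t
  proof -
    have "\<phi> t \<in> {\<phi> a..\<phi> b}" using img that by blast
    then have "cl (\<phi> t) = \<phi> t" by (auto simp: cl_def)
    then show ?thesis using T0 that by (simp add: T_def)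
  qed
  have cl_in: "cl s \<in> {\<phi> a..\<phi> b}" for s using phi_ab by (auto simp: cl_def)
  have "continuous_on (\<phi> ` {a..b}) T0"
    using phi_cont T0 by (intro continuous_on_inv) auto
  then have "continuous_on {\<phi> a..\<phi> b} T0" by (simp add: img)
  moreover have "continuous_on UNIV cl"
    unfolding cl_def by (intro continuous_intros)
  ultimately have T_cont: "continuous_on UNIV T"
    unfolding T_def using cl_in by (intro continuous_on_compose2[of "{\<phi> a..\<phi> b}" T0 UNIV cl]) auto
  have T_mono: "mono T"
  proof (rule monoI)
    fix s s' :: real assume "s \<le> s'"
    then have le: "cl s \<le> cl s'" by (auto simp: cl_def)
    obtain t t' where t: "t \<in> {a..b}" "\<phi> t = cl s" "t' \<in> {a..b}" "\<phi> t' = cl s'"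
      using surj cl_in by metis
    then have "t \<le> t'" using phi_less[of t' t] le by (cases "t \<le> t'") auto
    moreover have "T s = t" "T s' = t'" using T0[OF t(1)] T0[OF t(3)] t(2,4) by (auto simp: T_def)
    ultimately show "T s \<le> T s'" by simp
  qed
  \<comment> \<open>The running maximum starts at \<open>f a\<close> and ends at or above
    \<open>f b\<close>, so its chord is at least as steep as that of \<open>f\<close>.\<close>
  have "running_max f a a = f a" by (simp add: running_max_def)
  moreover have "f b \<le> running_max f a b" using running_max_ge[OF cont, of b b] ab by simp
  ultimately have "(1 + c) * (b - a) < \<phi> b - \<phi> a"
    using steep by (simp add: \<phi>_def algebra_simps)
  then have "T (\<phi> b) - T (\<phi> a) < 1 / (1 + c) * (\<phi> b - \<phi> a)"
    using T[of a] T[of b] ab c by (simp add: field_simps)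
  then obtain P where P: "perfect_set P" "P \<subseteq> {\<phi> a<..<\<phi> b}"
    "\<And>s. s \<in> P \<Longrightarrow> \<exists>D<1 / (1 + c). (T has_real_derivative D) (at s)"
    using perfect_set_small_derivative[OF T_mono T_cont phi_ab] by blast
  have rep: "\<exists>t\<in>{a<..<b}. \<phi> t = s \<and> T s = t" if s: "s \<in> P" for s
  proof -
    have "s \<in> {\<phi> a<..<\<phi> b}" using P s by blast
    moreover from this obtain t where t: "t \<in> {a..b}" "\<phi> t = s"
      using surj[of s] by auto
    ultimately have "t \<noteq> a" "t \<noteq> b" by auto
    then show ?thesis using t T by (intro bexI[of _ t]) auto
  qed
  show ?thesis
  proof
    have "P \<subseteq> {\<phi> a..\<phi> b}" using P(2) by force
    then have "bounded P" by (rule bounded_subset[OF bounded_closed_interval])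
    moreover have "inj_on T P" by (intro inj_onI) (metis rep)
    ultimately show "perfect_set (T ` P)"
      using P T_cont by (intro perfect_set_continuous_injective_image)
    show "T ` P \<subseteq> {a<..<b}" using rep by blast
    fix t assume "t \<in> T ` P"
    then obtain s where s: "s \<in> P" "t = T s" by blast
    then have t: "t \<in> {a<..<b}" "\<phi> t = s" using rep by auto
    obtain D where D: "D < 1 / (1 + c)" "(T has_real_derivative D) (at s)"
      using P(3) s by blast
    have near: "\<forall>\<^sub>F y in at t. y \<in> {a<..<b} \<and> y \<noteq> t"
      using eventually_at_in_open[of "{a<..<b}" t] t by (auto elim: eventually_mono)
    have "isCont \<phi> t"
      using phi_cont t by (metis continuous_on_interior interior_atLeastAtMost_real)
    moreover have "\<forall>\<^sub>F y in at t. \<phi> y \<noteq> s"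
      using near
    proof eventually_elim
      case (elim y)
      then show ?case using phi_less[of y t] phi_less[of t y] t by (cases "y < t") auto
    qed
    \<comment> \<open>This permits the substitution \<open>r = \<phi> y\<close> in the difference
      quotient of \<open>T\<close> at \<open>s\<close>: \<open>\<phi> y\<close> tends to
      \<open>s\<close> while avoiding it.\<close>
    ultimately have "filterlim \<phi> (at s) (at t)"
      using t by (auto simp: filterlim_at isCont_def)
    moreover have "((\<lambda>r. (T r - T s) / (r - s)) \<longlongrightarrow> D) (at s)"
      using D by (simp add: has_field_derivative_iff)
    ultimately have "((\<lambda>y. (T (\<phi> y) - T s) / (\<phi> y - s)) \<longlongrightarrow> D) (at t)"
      by (rule filterlim_compose[rotated])
    moreover have "\<forall>\<^sub>F y in at t. (T (\<phi> y) - T s) / (\<phi> y - s) = (y - t) / (\<phi> y - \<phi> t)"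
      using near by eventually_elim (use T t s in auto)
    ultimately have "((\<lambda>y. (y - t) / (\<phi> y - \<phi> t)) \<longlongrightarrow> D) (at t)"
      by (simp add: tendsto_cong)
    then have lim: "((\<lambda>y. (y - t) / ((y + running_max f a y) - (t + running_max f a t))) \<longlongrightarrow> D) (at t)"
      unfolding \<phi>_def .
    have "(1 + c) * D < 1" using D(1) c by (simp add: field_simps)
    then show "has_ext_derivative_within f t UNIV"
      by (rule ext_derivative_from_running_max[OF cont c _ t(1) lim, rotated]) (rule star)
  qed
qed

text \<open>Adding \<open>c * x\<close> makes \<open>f\<close> nondecreasing; derivatives of the sum
  pass back to \<open>f\<close> by subtracting the linear term.\<close>

lemma perfect_ext_derivative_Lipschitz:
  fixes f :: "real \<Rightarrow> real" and a b c :: real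
  assumes cont: "continuous_on {a..b} f" and ab: "a < b"
    and lip: "\<And>x z. \<lbrakk>a \<le> x; x < z; z \<le> b\<rbrakk> \<Longrightarrow> f x - f z \<le> c * (z - x)"
  obtains P where "perfect_set P" "P \<subseteq> {a<..<b}"
    "\<And>t. t \<in> P \<Longrightarrow> has_ext_derivative_within f t UNIV"
proof -
  define cl where "cl s = max a (min b s)" for s
  define T where "T s = f (cl s) + c * cl s" for s
  have cl_in: "cl s \<in> {a..b}" for s using ab by (auto simp: cl_def)
  have cl_cont: "continuous_on UNIV cl"
    unfolding cl_def by (intro continuous_intros)
  have "continuous_on UNIV (\<lambda>s. f (cl s))"
    using cont cl_cont cl_in by (intro continuous_on_compose2[of "{a..b}" f UNIV cl]) auto
  then have T_cont: "continuous_on UNIV T"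
    unfolding T_def by (intro continuous_intros cl_cont)
  have T_mono: "mono T"
  proof (rule monoI)
    fix s s' :: real assume "s \<le> s'"
    then have "cl s \<le> cl s'" by (auto simp: cl_def)
    then show "T s \<le> T s'"
      using lip[of "cl s" "cl s'"] cl_in[of s] cl_in[of s']
      by (cases "cl s = cl s'") (auto simp: T_def algebra_simps)
  qed
  \<comment> \<open>Any number above the average slope of \<open>T\<close> serves as the bound on
    the derivative.\<close>
  define k where "k = (T b - T a) / (b - a) + 1"
  have "T b - T a < k * (b - a)" using ab by (simp add: k_def distrib_right)
  then obtain P where P: "perfect_set P" "P \<subseteq> {a<..<b}"
    "\<And>s. s \<in> P \<Longrightarrow> \<exists>D<k. (T has_real_derivative D) (at s)"
    using perfect_set_small_derivative[OF T_mono T_cont ab] by blast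
  show ?thesis
  proof (rule that[OF P(1,2)])
    fix t assume t: "t \<in> P"
    then obtain D where D: "(T has_real_derivative D) (at t)" using P by blast
    have deriv: "((\<lambda>y. T y - c * y) has_real_derivative D - c) (at t)"
      by (auto intro!: derivative_eq_intros D)
    have ev: "\<forall>\<^sub>F y in nhds t. T y - c * y = f y"
    proof -
      have "\<forall>\<^sub>F y in nhds t. y \<in> {a<..<b}"
        using P(2) t by (intro eventually_nhds_in_open) auto
      then show ?thesis by eventually_elim (simp add: T_def cl_def)
    qed
    have "(f has_real_derivative D - c) (at t)"
      using iffD1[OF DERIV_cong_ev[OF refl ev refl] deriv] .
    then show "has_ext_derivative_within f t UNIV"
      unfolding has_ext_derivative_within_def has_field_derivative_iff using tendsto_ereal by blast
  qed
qed

text \<open>Either no chord of \<open>f\<close> falls with slope below \<open>- c\<close>, which is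
  the one-sided Lipschitz case, or \<open>- f\<close> is steep on a subinterval; \<open>star\<close>
  survives both the restriction and the change of sign.\<close>

lemma perfect_ext_derivative_bounded_turning:
  fixes f :: "real \<Rightarrow> real" and a b c :: real
  assumes cont: "continuous_on {a..b} f" and c: "c \<ge> 0" and ab: "a < b"
    and star: "\<And>u w v. \<lbrakk>a \<le> u; u \<le> w; w \<le> v; v \<le> b; f u = f v\<rbrakk> \<Longrightarrow> \<bar>f w - f u\<bar> \<le> c * (v - u)"
  obtains P where "perfect_set P" "P \<subseteq> {a<..<b}"
    "\<And>t. t \<in> P \<Longrightarrow> has_ext_derivative_within f t UNIV"
proof (cases "\<exists>x z. a \<le> x \<and> x < z \<and> z \<le> b \<and> f x - f z > c * (z - x)")
  case True
  then obtain x z where xz: "a \<le> x" "x < z" "z \<le> b" "f x - f z > c * (z - x)" by blast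
  have cont': "continuous_on {x..z} (\<lambda>t. - f t)"
    using cont xz by (intro continuous_on_minus) (auto elim: continuous_on_subset)
  have steep: "- f z - - f x > c * (z - x)" using xz by simp
  show ?thesis
  proof (rule perfect_ext_derivative_steep[OF cont' c xz(2) _ steep])
    fix u w v assume "x \<le> u" "u \<le> w" "w \<le> v" "v \<le> z" "- f u = - f v"
    then show "\<bar>- f w - - f u\<bar> \<le> c * (v - u)" using star[of u w v] xz by auto
  next
    fix P assume P: "perfect_set P" "P \<subseteq> {x<..<z}"
      "\<And>t. t \<in> P \<Longrightarrow> has_ext_derivative_within (\<lambda>t. - f t) t UNIV"
    show ?thesis
    proof (rule that[OF P(1)])
      show "P \<subseteq> {a<..<b}" using P(2) xz by force
      show "has_ext_derivative_within f t UNIV" if "t \<in> P" for t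
        using P(3)[OF that] by (rule has_ext_derivative_within_uminus)
    qed
  qed
next
  case False
  show ?thesis
  proof (rule perfect_ext_derivative_Lipschitz[OF cont ab])
    fix x z assume "a \<le> x" "x < z" "z \<le> b"
    then show "f x - f z \<le> c * (z - x)" using False by (meson not_le)
  qed (fact that)
qed

subsection \<open>Monotone pieces of a graph\<close>

text \<open>By \<open>sep\<close>, the middle of three points of \<open>D\<close> in the given order
  is also the middle in the natural order, so each triple is ordered naturally or in reverse.
  Reversal costs one triangle inequality, hence \<open>c0 + 1\<close>; continuity extends the
  estimate from \<open>D\<close> to \<open>{a..b}\<close>.\<close>

lemma monotone_dense_graph_bounded_turning:
  fixes f :: "real \<Rightarrow> real" and a b :: real
  assumes cont: "continuous_on {a..b} f"
    and D: "D \<subseteq> {a..b}" "{a..b} \<subseteq> closure D"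
    and S: "monotone_set S" "(\<lambda>x. (x, f x)) ` D \<subseteq> S"
  shows "\<exists>c\<ge>0. \<forall>x y z. a \<le> x \<and> x \<le> y \<and> y \<le> z \<and> z \<le> b \<longrightarrow>
           dist (x, f x) (y, f y) \<le> c * dist (x, f x) (z, f z)"
proof -
  define p where "p x = (x, f x)" for x
  obtain r c0 where r: "linear_order_on S r" and c0: "c0 > 0"
    and mono: "\<forall>x\<in>S. \<forall>y\<in>S. \<forall>z\<in>S.
        (x, y) \<in> r \<and> x \<noteq> y \<and> (y, z) \<in> r \<and> y \<noteq> z \<longrightarrow> dist x y \<le> c0 * dist x z"
    using S(1) unfolding monotone_set_def by blast
  define lt where "lt x y \<longleftrightarrow> x \<in> D \<and> y \<in> D \<and> (p x, p y) \<in> r \<and> x \<noteq> y" for x y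
  have pS: "p x \<in> S" if "x \<in> D" for x using S(2) that by (auto simp: p_def)
  have p_inj: "p x = p y \<longleftrightarrow> x = y" for x y by (auto simp: p_def)
  have p_cont: "continuous_on {a..b} p"
    unfolding p_def by (intro continuous_intros cont)
  have lt_total: "lt x y \<or> lt y x" if "x \<in> D" "y \<in> D" "x \<noteq> y" for x y
    using r that pS p_inj unfolding linear_order_on_def total_on_def lt_def by metis
  have lt_dist: "dist (p x) (p y) \<le> c0 * dist (p x) (p z)" if "lt x y" "lt y z" for x y z
    using mono that pS p_inj unfolding lt_def by blast
  \<comment> \<open>If \<open>s\<close> separates \<open>y\<close> from \<open>z\<close> in the given order but lies outside the interval they span, then
    by connectedness the two sides of \<open>s\<close> accumulate at a common point of that interval, which the
    monotonicity inequality identifies with \<open>s\<close>.\<close>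
  have sep: "min y z < s \<and> s < max y z" if lt: "lt y s" "lt s z" for y s z
  proof (rule ccontr)
    assume not: "\<not> ?thesis"
    define U where "U = {w. lt w s}"
    define W where "W = {w. lt s w}"
    have in_D: "y \<in> D" "s \<in> D" "z \<in> D" "y \<noteq> s" "z \<noteq> s" using lt by (auto simp: lt_def)
    let ?J = "{min y z..max y z}"
    have sJ: "s \<notin> ?J" using not in_D by (auto simp: min_def max_def split: if_splits)
    have J: "?J \<subseteq> {a..b}" using in_D D(1) by (auto simp: min_def max_def)
    have "D \<subseteq> U \<union> W \<union> {s}" using lt_total in_D unfolding U_def W_def by blast
    then have "closure D \<subseteq> closure (U \<union> W \<union> {s})" by (rule closure_mono)
    also have "\<dots> = closure U \<union> closure W \<union> {s}" by (simp only: closure_Un closure_closed closed_singleton)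
    finally have "closure D \<subseteq> closure U \<union> closure W \<union> {s}" .
    then have "?J \<subseteq> closure U \<union> closure W" using J D(2) sJ by blast
    moreover have "closure U \<inter> ?J \<noteq> {}" "closure W \<inter> ?J \<noteq> {}"
    proof -
      have "y \<in> closure U" "z \<in> closure W"
        using lt closure_subset[of U] closure_subset[of W] by (auto simp: U_def W_def)
      moreover have "y \<in> ?J" "z \<in> ?J" by auto
      ultimately show "closure U \<inter> ?J \<noteq> {}" "closure W \<inter> ?J \<noteq> {}" by blast+
    qed
    moreover have "connected ?J" by simp
    ultimately have "closure U \<inter> closure W \<inter> ?J \<noteq> {}"
      unfolding connected_closed by (metis closed_closure)
    then obtain t where t: "t \<in> closure U" "t \<in> closure W" "t \<in> ?J" by blast
    obtain u where u: "\<And>n::nat. u n \<in> U" "u \<longlonglongrightarrow> t"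
      using t(1) unfolding closure_sequential by blast
    obtain w where w: "\<And>n::nat. w n \<in> W" "w \<longlonglongrightarrow> t"
      using t(2) unfolding closure_sequential by blast
    have t': "t \<in> {a..b}" using t J by blast
    have "u n \<in> {a..b}" "w n \<in> {a..b}" for n
      using u(1)[of n] w(1)[of n] D(1) by (auto simp: U_def W_def lt_def)
    then have lims: "(\<lambda>n. p (u n)) \<longlonglongrightarrow> p t" "(\<lambda>n. p (w n)) \<longlonglongrightarrow> p t"
      using continuous_on_tendsto_compose[OF p_cont u(2) t']
        continuous_on_tendsto_compose[OF p_cont w(2) t'] by auto
    have "dist (p (u n)) (p s) \<le> c0 * dist (p (u n)) (p (w n))" for n
      using u(1)[of n] w(1)[of n] by (intro lt_dist) (auto simp: U_def W_def)
    moreover have "(\<lambda>n. dist (p (u n)) (p s)) \<longlonglongrightarrow> dist (p t) (p s)"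
      "(\<lambda>n. c0 * dist (p (u n)) (p (w n))) \<longlonglongrightarrow> c0 * dist (p t) (p t)"
      by (intro tendsto_intros lims)+
    ultimately have "dist (p t) (p s) \<le> c0 * dist (p t) (p t)"
      by (intro LIMSEQ_le) auto
    then have "t = s" by (simp add: p_inj)
    then show False using sJ t by simp
  qed
  have on_D: "dist (p x) (p y) \<le> (c0 + 1) * dist (p x) (p z)"
    if xyz: "x \<in> D" "y \<in> D" "z \<in> D" "x < y" "y < z" for x y z
  proof -
    \<comment> \<open>The four alternatives put \<open>x\<close> or \<open>z\<close> in the middle
      of the given order, which \<open>sep\<close> excludes.\<close>
    have no: "\<not> (lt y x \<and> lt x z)" "\<not> (lt z x \<and> lt x y)" "\<not> (lt x z \<and> lt z y)" "\<not> (lt y z \<and> lt z x)"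
      using sep[of y x z] sep[of z x y] sep[of x z y] sep[of y z x] xyz by auto
    moreover have "x \<noteq> y" "y \<noteq> z" "x \<noteq> z" using xyz by auto
    ultimately consider "lt x y" "lt y z" | "lt z y" "lt y x"
      using lt_total[of x y] lt_total[of y z] lt_total[of x z] xyz(1-3) by blast
    then show ?thesis
    proof cases
      case 1
      then have "dist (p x) (p y) \<le> c0 * dist (p x) (p z)" by (rule lt_dist)
      then show ?thesis by (simp add: distrib_right add_increasing2)
    next
      case 2
      then have "dist (p z) (p y) \<le> c0 * dist (p z) (p x)" by (rule lt_dist)
      moreover have "dist (p x) (p y) \<le> dist (p x) (p z) + dist (p z) (p y)"
        by (rule dist_triangle)
      ultimately show ?thesis by (simp add: distrib_right dist_commute)
    qed
  qed
  have "dist (p x) (p y) \<le> (c0 + 1) * dist (p x) (p z)"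
    if xyz: "a \<le> x" "x \<le> y" "y \<le> z" "z \<le> b" for x y z
  proof (cases "x = y \<or> y = z")
    case True
    then show ?thesis using c0 by (auto simp: distrib_right)
  next
    case False
    then have less: "x < y" "y < z" using xyz by auto
    have "x \<in> closure D" "y \<in> closure D" "z \<in> closure D" using D(2) xyz by auto
    then obtain X Y Z where X: "\<And>n::nat. X n \<in> D" "X \<longlonglongrightarrow> x"
      and Y: "\<And>n::nat. Y n \<in> D" "Y \<longlonglongrightarrow> y" and Z: "\<And>n::nat. Z n \<in> D" "Z \<longlonglongrightarrow> z"
      unfolding closure_sequential by blast
    \<comment> \<open>Strict inequalities between the limits hold eventually for the approximants,
      so \<open>on_D\<close> applies to them.\<close>
    have "\<forall>\<^sub>F n in sequentially. 0 < Y n - X n" "\<forall>\<^sub>F n in sequentially. 0 < Z n - Y n"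
      using order_tendstoD(1)[OF tendsto_diff[OF Y(2) X(2)], of 0]
        order_tendstoD(1)[OF tendsto_diff[OF Z(2) Y(2)], of 0] less by auto
    then have ev: "\<forall>\<^sub>F n in sequentially.
        dist (p (X n)) (p (Y n)) \<le> (c0 + 1) * dist (p (X n)) (p (Z n))"
      by eventually_elim (use on_D X Y Z in auto)
    have mem: "X n \<in> {a..b}" "Y n \<in> {a..b}" "Z n \<in> {a..b}" for n using X Y Z D(1) by blast+
    have "x \<in> {a..b}" "y \<in> {a..b}" "z \<in> {a..b}" using xyz by auto
    then have lims: "(\<lambda>n. p (X n)) \<longlonglongrightarrow> p x" "(\<lambda>n. p (Y n)) \<longlonglongrightarrow> p y" "(\<lambda>n. p (Z n)) \<longlonglongrightarrow> p z"
      using mem by (auto intro!: continuous_on_tendsto_compose[OF p_cont] X(2) Y(2) Z(2))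
    show ?thesis
      by (rule tendsto_le[OF _ _ _ ev]) (auto intro!: tendsto_intros lims)
  qed
  then show ?thesis using c0 by (intro exI[of _ "c0 + 1"]) (auto simp: p_def)
qed

section \<open>Baire category and the choice of a subinterval\<close>

lemma countable_cover_somewhere_dense:
  fixes D :: "nat \<Rightarrow> real set"
  assumes ab: "a < b" and cover: "{a..b} \<subseteq> (\<Union>n. D n)"
  obtains n a' b' where "a \<le> a'" "a' < b'" "b' \<le> b" "{a'..b'} \<subseteq> closure (D n \<inter> {a'..b'})"
proof -
  have "\<exists>n. \<not> {a..b} \<subseteq> closure ({a..b} - closure (D n))"
  proof (rule ccontr)
    assume "\<not> ?thesis"
    then have dense: "{a..b} \<subseteq> closure ({a..b} - closure (D n))" for n by blast
    \<comment> \<open>These sets are relatively open and, by the contrary assumption, dense; Baire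
      makes their intersection dense, while the cover makes it empty.\<close>
    define \<G> where "\<G> = range (\<lambda>n. {a..b} - closure (D n))"
    have "{a..b} \<subseteq> closure (\<Inter>\<G>)"
    proof (rule Baire)
      show "countable \<G>" by (simp add: \<G>_def)
      fix T assume "T \<in> \<G>"
      then obtain n where T: "T = {a..b} - closure (D n)" by (auto simp: \<G>_def)
      then have "T = {a..b} \<inter> - closure (D n)" by blast
      then show "openin (top_of_set {a..b}) T \<and> {a..b} \<subseteq> closure T"
        using dense[of n] T by (metis closed_closure open_Compl openin_open_Int)
    qed simp
    moreover have "\<Inter>\<G> = {}" using cover closure_subset unfolding \<G>_def by blast
    ultimately show False using ab by simp
  qed
  then obtain n x where x: "x \<in> {a..b}" "x \<notin> closure ({a..b} - closure (D n))" by blast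
  then obtain e where "e > 0" "\<And>y. y \<in> {a..b} - closure (D n) \<Longrightarrow> \<not> dist y x < e"
    unfolding closure_approachable[of x "{a..b} - closure (D n)"] by blast
  then have e: "e > 0" "ball x e \<inter> ({a..b} - closure (D n)) = {}"
    by (auto simp: dist_commute)
  define a' where "a' = max a (x - e/2)"
  define b' where "b' = min b (x + e/2)"
  have ab': "a \<le> a'" "a' < b'" "b' \<le> b" using x e ab by (auto simp: a'_def b'_def)
  have "{a'..b'} \<subseteq> ball x e \<inter> {a..b}"
    using e by (auto simp: a'_def b'_def dist_real_def)
  then have sub: "{a'..b'} \<subseteq> closure (D n)" using e by blast
  \<comment> \<open>Passing to the open interval allows it to be intersected inside the closure;
    taking closures restores the end points.\<close>
  have "{a'..b'} = closure {a'<..<b'}" using ab' by simp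
  also have "\<dots> \<subseteq> closure (D n \<inter> {a'..b'})"
  proof (rule closure_minimal)
    have "{a'<..<b'} \<subseteq> {a'<..<b'} \<inter> closure (D n)" using sub by force
    also have "\<dots> \<subseteq> closure ({a'<..<b'} \<inter> D n)" by (rule open_Int_closure_subset) simp
    also have "\<dots> \<subseteq> closure (D n \<inter> {a'..b'})" by (rule closure_mono) auto
    finally show "{a'<..<b'} \<subseteq> closure (D n \<inter> {a'..b'})" .
  qed simp
  finally show ?thesis using ab' that by blast
qed

lemma interval_open_contains_Icc:
  fixes I V :: "real set"
  assumes I: "is_interval I" "\<exists>a\<in>I. \<exists>b\<in>I. a < b" and V: "open V" "V \<inter> I \<noteq> {}"
  obtains a b where "a < b" "{a..b} \<subseteq> V \<inter> I"
proof -
  obtain x where x: "x \<in> V" "x \<in> I" using V by blast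
  then obtain e where e: "e > 0" "ball x e \<subseteq> V" using V open_contains_ball by blast
  \<comment> \<open>A second point of \<open>I\<close> shows on which side of \<open>x\<close> the
    interval extends.\<close>
  obtain y where y: "y \<in> I" "y \<noteq> x" using I(2) by (metis less_irrefl)
  have in_I: "t \<in> I" if "u \<in> I" "v \<in> I" "u \<le> t" "t \<le> v" for u v t
    using mem_is_interval_1_I[OF I(1)] that by blast
  show ?thesis
  proof (cases "x < y")
    case True
    show ?thesis
    proof (rule that)
      show "x < min y (x + e/2)" using True e by simp
      have "{x..min y (x + e/2)} \<subseteq> ball x e" using e by (auto simp: dist_real_def)
      moreover have "{x..min y (x + e/2)} \<subseteq> I" using in_I[OF x(2) y(1)] by auto
      ultimately show "{x..min y (x + e/2)} \<subseteq> V \<inter> I" using e by blast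
    qed
  next
    case False
    show ?thesis
    proof (rule that)
      show "max y (x - e/2) < x" using False y e by simp
      have "{max y (x - e/2)..x} \<subseteq> ball x e" using e by (auto simp: dist_real_def)
      moreover have "{max y (x - e/2)..x} \<subseteq> I" using in_I[OF y(1) x(2)] by auto
      ultimately show "{max y (x - e/2)..x} \<subseteq> V \<inter> I" using e by blast
    qed
  qed
qed

theorem theorem4p5:
  fixes I :: "real set" and f :: "real \<Rightarrow> real"
  assumes "is_interval I"
    and "\<exists>a\<in>I. \<exists>b\<in>I. a < b"
    and "continuous_on I f"
    and "sigma_monotone ((\<lambda>x. (x, f x)) ` I)"
  shows "\<forall>V. open V \<and> V \<inter> I \<noteq> {} \<longrightarrow>
           (\<exists>P. perfect_set P \<and> P \<subseteq> V \<inter> I \<inter> {x. has_ext_derivative_within f x I})"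
proof (intro allI impI)
  fix V :: "real set" assume "open V \<and> V \<inter> I \<noteq> {}"
  then obtain a b where ab: "a < b" "{a..b} \<subseteq> V \<inter> I"
    using interval_open_contains_Icc[OF assms(1,2)] by blast
  obtain A where A: "\<And>n::nat. monotone_set (A n)" "(\<lambda>x. (x, f x)) ` I = (\<Union>n. A n)"
    using assms(4) unfolding sigma_monotone_def by blast
  \<comment> \<open>The Baire argument runs on abscissae, so the pieces of the graph are projected
    to the line.\<close>
  have "{a..b} \<subseteq> (\<Union>n. {x. (x, f x) \<in> A n})" using ab A(2) by blast
  then obtain n a' b' where ab': "a \<le> a'" "a' < b'" "b' \<le> b"
    and dense: "{a'..b'} \<subseteq> closure ({x. (x, f x) \<in> A n} \<inter> {a'..b'})"
    by (rule countable_cover_somewhere_dense[OF ab(1)])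
  have sub: "{a'..b'} \<subseteq> V \<inter> I" using ab ab' by auto
  then have cont: "continuous_on {a'..b'} f"
    using assms(3) continuous_on_subset by blast
  have "(\<lambda>x. (x, f x)) ` ({x. (x, f x) \<in> A n} \<inter> {a'..b'}) \<subseteq> A n" by blast
  then obtain c where c: "c \<ge> 0"
    and turn: "\<And>x y z. a' \<le> x \<and> x \<le> y \<and> y \<le> z \<and> z \<le> b' \<Longrightarrow>
       dist (x, f x) (y, f y) \<le> c * dist (x, f x) (z, f z)"
    using monotone_dense_graph_bounded_turning[OF cont Int_lower2 dense A(1)[of n]] by blast
  \<comment> \<open>At equal heights the outer graph points are at distance \<open>v - u\<close>,
    while a difference of heights is at most the distance in the plane.\<close>
  have star: "\<bar>f w - f u\<bar> \<le> c * (v - u)"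
    if "a' \<le> u" "u \<le> w" "w \<le> v" "v \<le> b'" "f u = f v" for u w v
  proof -
    have "\<bar>f w - f u\<bar> \<le> dist (u, f u) (w, f w)"
      using dist_snd_le[of "(u, f u)" "(w, f w)"] by (simp add: dist_real_def abs_minus_commute)
    also have "\<dots> \<le> c * dist (u, f u) (v, f v)" using that by (intro turn conjI)
    also have "\<dots> = c * (v - u)" using that by (simp add: dist_Pair_Pair dist_real_def)
    finally show ?thesis .
  qed
  show "\<exists>P. perfect_set P \<and> P \<subseteq> V \<inter> I \<inter> {x. has_ext_derivative_within f x I}"
  proof (rule perfect_ext_derivative_bounded_turning[OF cont c ab'(2)])
    fix P assume P: "perfect_set P" "P \<subseteq> {a'<..<b'}"
      "\<And>t. t \<in> P \<Longrightarrow> has_ext_derivative_within f t UNIV"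
    \<comment> \<open>The two-sided limit on the line restricts to \<open>I\<close>.\<close>
    have "has_ext_derivative_within f t I" if "t \<in> P" for t
      using P(3)[OF that] tendsto_within_subset[OF _ subset_UNIV]
      unfolding has_ext_derivative_within_def by blast
    moreover have "P \<subseteq> V \<inter> I" using P(2) sub by force
    ultimately show ?thesis using P(1) by blast
  qed (fact star)
qed

end
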